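(* Let $n>2$, let $q$ be a power of a prime, and let $\Gamma=(UT(n,\mathbb{F}_q),(U_i)_{1\le i\le n-1})$ be the unitriangular coset geometry. Let $\phi\in\mathrm{Aut}(UT(n,\mathbb{F}_q))$. Then $\phi$ is an automorphism of $\Gamma$ if and only if $\phi\in\langle\mathrm{Aut}_D,\mathrm{Aut}_F\rangle$, where $\mathrm{Aut}_D$ is the group of diagonal automorphisms of $UT(n,\mathbb{F}_q)$ and $\mathrm{Aut}_F$ is the group of field automorphisms of $\mathbb{F}_q$ (acting on $UT(n,\mathbb{F}_q)$).
   Context: $UT(n,\mathbb{F}_q)$ is the group of upper unitriangular $n\times n$ matrices over $\mathbb{F}_q$. For $1\le i\le n-1$ and $t\in\mathbb{F}_q$, $e_i(t)$ is the unitriangular matrix with $(i,i+1)$-entry $t$ and all other off-diagonal entries $0$. With $T$ a basis of $\mathbb{F}_q$ over its prime field, $U_i=\langle e_j(t)\mid t\in T,\ j\in\{1,\dots,n-1\}\setminus\{i\}\rangle$. The coset geometry $\Gamma$ has as elements of type $i\in\{1,\dots,n-1\}$ the left cosets $gU_i$, with $gU_i$ and $hU_j$ incident iff $gU_i\cap hU_j\ne\emptyset$. An automorphism of $\Gamma$ is a bijection on elements that respects incidence and preserves the type of every element. A group automorphism $\phi$ is said to be an automorphism of $\Gamma$ if its action on cosets, $gU_i\mapsto\phi(gU_i)$ (image as a set), is a type-preserving automorphism of $\Gamma$ (in particular each $\phi(gU_i)$ is a left coset of $U_i$). A diagonal automorphism is one of the form $x\mapsto DxD^{-1}$ with $D=\mathrm{diag}(\lambda_1,\dots,\lambda_n)$,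 all $\lambda_i\in\mathbb{F}_q\setminus\{0\}$; a field automorphism acts by applying an automorphism of the field $\mathbb{F}_q$ to every matrix entry. *)

theory Defs
  imports
    "Jordan_Normal_Form.Matrix"
    "HOL-Algebra.Algebra"
    "HOL-Algebra.Algebraic_Closure_Type"
begin

section \<open>Coset geometries\<close>

definition geom_elements :: "('g, 'm) monoid_scheme \<Rightarrow> 'i set \<Rightarrow> ('i \<Rightarrow> 'g set) \<Rightarrow> 'g set set" where
  "geom_elements G I U = (\<Union>i\<in>I. lcosets\<^bsub>G\<^esub> (U i))"

definition geom_incident :: "'g set \<Rightarrow> 'g set \<Rightarrow> bool" where
  "geom_incident A B \<longleftrightarrow> A \<inter> B \<noteq> {}"

text \<open>
  The elements of type \<open>i\<close> are the members of \<open>lcosets\<^bsub>G\<^esub> (U i)\<close>. The type of an element is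
  well defined when the subgroups \<open>U i\<close> are pairwise distinct, since a left coset of \<open>U\<close>
  determines \<open>U\<close>.
\<close>

definition geom_automorphism ::
  "('g, 'm) monoid_scheme \<Rightarrow> 'i set \<Rightarrow> ('i \<Rightarrow> 'g set) \<Rightarrow> ('g set \<Rightarrow> 'g set) \<Rightarrow> bool" where
  "geom_automorphism G I U f \<longleftrightarrow>
     bij_betw f (geom_elements G I U) (geom_elements G I U) \<and>
     (\<forall>A\<in>geom_elements G I U. \<forall>B\<in>geom_elements G I U.
        geom_incident (f A) (f B) \<longleftrightarrow> geom_incident A B) \<and>
     (\<forall>i\<in>I. \<forall>A\<in>geom_elements G I U. f A \<in> lcosets\<^bsub>G\<^esub> (U i) \<longleftrightarrow> A \<in> lcosets\<^bsub>G\<^esub> (U i))"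

definition acts_as_geom_automorphism ::
  "('g, 'm) monoid_scheme \<Rightarrow> 'i set \<Rightarrow> ('i \<Rightarrow> 'g set) \<Rightarrow> ('g \<Rightarrow> 'g) \<Rightarrow> bool" where
  "acts_as_geom_automorphism G I U \<phi> \<longleftrightarrow> geom_automorphism G I U (\<lambda>A. \<phi> ` A)"


section \<open>The unitriangular group and its coset geometry\<close>

definition UT :: "nat \<Rightarrow> 'a :: field mat monoid" where
  "UT n = \<lparr>carrier = {A \<in> carrier_mat n n. upper_triangular A \<and> (\<forall>r<n. A $$ (r, r) = 1)},
           mult = (*), one = 1\<^sub>m n\<rparr>"

text \<open>
  The index \<open>i\<close> of \<open>elem_mat n i t\<close> ranges over \<open>1, \<dots>, n - 1\<close>, whereas matrix positions are
  counted from \<open>0\<close>; so the entry \<open>t\<close>, at position \<open>(i, i + 1)\<close> when counting from \<open>1\<close>, is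
  at \<open>(i - 1, i)\<close>.
\<close>

definition elem_mat :: "nat \<Rightarrow> nat \<Rightarrow> 'a :: field \<Rightarrow> 'a mat" where
  "elem_mat n i t = mat n n (\<lambda>(r, c). if r = c then 1 else if r + 1 = i \<and> c = i then t else 0)"

definition prime_field :: "'a :: field set" where
  "prime_field = generate_field ring_of_type_algebra {}"

text \<open>
  The library's \<open>independent\<close> and \<open>Span\<close> work on lists, so a finite basis is presented by an
  enumeration; \<open>independent\<close> makes the list distinct.
\<close>

definition basis_over_prime_field :: "'a :: field set \<Rightarrow> bool" where
  "basis_over_prime_field T \<longleftrightarrow>
     (\<exists>ts. set ts = T \<and> ring.independent ring_of_type_algebra prime_field ts \<and>
           ring.Span ring_of_type_algebra prime_field ts = UNIV)"

definition UT_sub :: "nat \<Rightarrow> 'a :: field set \<Rightarrow> nat \<Rightarrow> 'a mat set" where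
  "UT_sub n T i = generate (UT n) {elem_mat n j t | j t. j \<in> {1..n - 1} - {i} \<and> t \<in> T}"


section \<open>Diagonal and field automorphisms\<close>

text \<open>
  Elements of \<open>auto G\<close> are extensional, hence the restrictions to the carrier.
\<close>

definition Aut_D :: "nat \<Rightarrow> ('a :: field mat \<Rightarrow> 'a mat) set" where
  "Aut_D n = {\<lambda>x\<in>carrier (UT n). mat_diag n d * x * mat_diag n (\<lambda>i. inverse (d i)) | d.
                \<forall>i<n. d i \<noteq> 0}"

definition Aut_F :: "nat \<Rightarrow> ('a :: field mat \<Rightarrow> 'a mat) set" where
  "Aut_F n = {\<lambda>x\<in>carrier (UT n). map_mat \<sigma> x | \<sigma>.
                \<sigma> \<in> ring_iso ring_of_type_algebra ring_of_type_algebra}"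

end

theory Submission
  imports Defs "Jordan_Normal_Form.Gauss_Jordan_Elimination"
begin

text \<open>
  A group automorphism \<open>\<phi>\<close> permutes the left cosets of \<open>U i\<close> exactly when it maps \<open>U i\<close> onto
  itself, because \<open>\<phi> ` U i\<close> is a coset containing \<open>1\<close>
  (\<open>acts_as_geom_automorphism_iff_stabilises\<close>). So the theorem is about the stabiliser of the
  subgroups \<open>UT_sub n T i\<close> in the automorphism group.

  Diagonal and field automorphisms map each simple root subgroup \<open>X i = {elem_mat n i t | t}\<close> to
  itself, and \<open>UT_sub n T i\<close> is generated by the \<open>X j\<close> with \<open>j \<noteq> i\<close>: a basis \<open>T\<close> yields all of
  \<open>X j\<close>, since the parameters \<open>t\<close> with \<open>elem_mat n j t \<in> UT_sub n T i\<close> form an additive group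
  and hence a space over the prime field.

  Conversely, let \<open>\<phi>\<close> preserve every \<open>UT_sub n T i\<close>. It then preserves
  \<open>X i = (\<Inter>j\<noteq>i. UT_sub n T j)\<close>, because an element of \<open>UT_sub n T j\<close> has zeros at all positions
  \<open>(r, c)\<close> with \<open>r < j \<le> c\<close> (\<open>Inter_UT_sub_eq_range_elem_mat\<close>). So
  \<open>\<phi> (elem_mat n i t) = elem_mat n i (a i t)\<close> for additive bijections \<open>a i\<close>. The commutator of
  the elements of \<open>X i\<close> and \<open>X (i + 1)\<close> with parameters \<open>s\<close> and \<open>t\<close> depends only on \<open>s * t\<close>,
  which gives \<open>a i s * a (i + 1) t = a i (s * t) * a (i + 1) 1\<close>. With \<open>s = 1\<close> this says that the
  normalised map \<open>\<sigma> t = a i t / a i 1\<close> is the same for all \<open>i\<close>; the general case says that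
  \<open>\<sigma>\<close> is multiplicative, hence a field automorphism. The remaining factors \<open>a i 1\<close> are the ratios of
  consecutive entries of a diagonal matrix
  (\<open>root_preserving_auto_is_diagonal_times_field\<close>). Thus \<open>\<phi>\<close> agrees with a product of a diagonal
  and a field automorphism on the subgroups \<open>X i\<close>, and these generate the whole group
  (\<open>UT_generated_by_elem_mats\<close>).
\<close>

section \<open>Automorphisms of a coset geometry\<close>

lemma autoD:
  assumes "\<phi> \<in> auto G"
  shows "\<phi> \<in> hom G G" "bij_betw \<phi> (carrier G) (carrier G)" "\<phi> \<in> extensional (carrier G)"
  using assms by (auto simp: auto_def Bij_def)

lemma (in group) image_l_coset:
  assumes "\<phi> \<in> hom G G" "g \<in> carrier G" "S \<subseteq> carrier G"
  shows "\<phi> ` (g <# S) = \<phi> g <# (\<phi> ` S)"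
proof -
  have "\<phi> (g \<otimes> s) = \<phi> g \<otimes> \<phi> s" if "s \<in> S" for s
    using assms that by (auto intro: hom_mult)
  then show ?thesis
    unfolding l_coset_def by force
qed

text \<open>
  Preservation of types forces \<open>\<phi> ` U i\<close> to be a coset of \<open>U i\<close>; as it contains \<open>\<one>\<close>, it is
  \<open>U i\<close>. In the other direction \<open>\<phi> ` (g <# U i) = \<phi> g <# U i\<close>, and bijectivity of \<open>\<phi>\<close> on
  the group gives bijectivity on the elements and invariance of incidence.
\<close>
lemma (in group) acts_as_geom_automorphism_iff_stabilises:
  assumes phi: "\<phi> \<in> auto G" and U: "\<And>i. i \<in> I \<Longrightarrow> subgroup (U i) G"
  shows "acts_as_geom_automorphism G I U \<phi> \<longleftrightarrow> (\<forall>i\<in>I. \<phi> ` U i = U i)"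
proof
  assume "acts_as_geom_automorphism G I U \<phi>"
  then have type: "A \<in> lcosets (U i) \<Longrightarrow> \<phi> ` A \<in> lcosets (U i)" if "i \<in> I" for i A
    using that unfolding acts_as_geom_automorphism_def geom_automorphism_def geom_elements_def
    by blast
  show "\<forall>i\<in>I. \<phi> ` U i = U i"
  proof
    fix i assume i: "i \<in> I"
    interpret U: subgroup "U i" G by (rule U[OF i])
    have "\<one> <# U i = U i"
      using lcos_mult_one[OF U.subset] .
    then have "U i \<in> lcosets (U i)"
      unfolding LCOSETS_def by (auto intro!: bexI[of _ \<one>])
    from type[OF i this] obtain g where g: "g \<in> carrier G" "\<phi> ` U i = g <# U i"
      unfolding LCOSETS_def by auto
    have "\<phi> \<one> = \<one>"
      using autoD(1)[OF phi] hom_one is_group by blast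
    then have "\<one> \<in> g <# U i"
      using g(2) U.one_closed by (metis imageI)
    then have "g <# U i = \<one> <# U i"
      using g(1) U[OF i] l_repr_independence by blast
    then show "\<phi> ` U i = U i"
      using g(2) \<open>\<one> <# U i = U i\<close> by simp
  qed
next
  assume stab: "\<forall>i\<in>I. \<phi> ` U i = U i"
  have sub: "U i \<subseteq> carrier G" if "i \<in> I" for i
    using subgroup.subset[OF U[OF that]] .
  have inj: "inj_on \<phi> (carrier G)" and onto: "\<phi> ` carrier G = carrier G"
    using autoD(2)[OF phi] by (auto simp: bij_betw_def)
  have lcosI: "g <# S \<in> lcosets S" if "g \<in> carrier G" for g S
    using that unfolding LCOSETS_def by blast
  have coset: "\<phi> ` (g <# U i) = \<phi> g <# U i" if "i \<in> I" "g \<in> carrier G" for i g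
    using image_l_coset[OF autoD(1)[OF phi] that(2) sub[OF that(1)]] stab that(1) by simp
  have elem_sub: "A \<subseteq> carrier G" if A: "A \<in> geom_elements G I U" for A
  proof -
    obtain i g where "i \<in> I" "g \<in> carrier G" "A = g <# U i"
      using A unfolding geom_elements_def LCOSETS_def by auto
    then show ?thesis
      using l_coset_subset_G[OF sub] by simp
  qed
  have forward: "\<phi> ` A \<in> lcosets (U i)" if i: "i \<in> I" and A: "A \<in> lcosets (U i)" for i A
  proof -
    obtain g where g: "g \<in> carrier G" "A = g <# U i"
      using A unfolding LCOSETS_def by auto
    have "\<phi> g \<in> carrier G"
      using onto g(1) by blast
    then show ?thesis
      unfolding g(2) coset[OF i g(1)] by (rule lcosI)
  qed
  have backward: "\<exists>B\<in>lcosets (U i). \<phi> ` B = A" if i: "i \<in> I" and A: "A \<in> lcosets (U i)" for i A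
  proof -
    obtain g where g: "g \<in> carrier G" "A = g <# U i"
      using A unfolding LCOSETS_def by auto
    have "g \<in> \<phi> ` carrier G"
      unfolding onto by (rule g(1))
    then obtain h where h: "h \<in> carrier G" "\<phi> h = g"
      by auto
    have "\<phi> ` (h <# U i) = A"
      using coset[OF i h(1)] h(2) g(2) by simp
    then show ?thesis
      using lcosI[OF h(1)] by blast
  qed
  have inj_sets: "inj_on (\<lambda>A. \<phi> ` A) (geom_elements G I U)"
    using inj elem_sub by (intro inj_onI) (simp add: inj_on_image_eq_iff)
  have "(\<lambda>A. \<phi> ` A) ` geom_elements G I U = geom_elements G I U"
  proof
    show "(\<lambda>A. \<phi> ` A) ` geom_elements G I U \<subseteq> geom_elements G I U"
      using forward unfolding geom_elements_def by blast
    show "geom_elements G I U \<subseteq> (\<lambda>A. \<phi> ` A) ` geom_elements G I U"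
    proof
      fix A assume "A \<in> geom_elements G I U"
      then obtain i where i: "i \<in> I" "A \<in> lcosets (U i)"
        unfolding geom_elements_def by blast
      obtain B where B: "B \<in> lcosets (U i)" "\<phi> ` B = A"
        using backward[OF i] by blast
      moreover from B(1) i(1) have "B \<in> geom_elements G I U"
        unfolding geom_elements_def by blast
      ultimately show "A \<in> (\<lambda>A. \<phi> ` A) ` geom_elements G I U"
        by blast
    qed
  qed
  moreover have "geom_incident (\<phi> ` A) (\<phi> ` B) \<longleftrightarrow> geom_incident A B"
    if "A \<in> geom_elements G I U" "B \<in> geom_elements G I U" for A B
    using inj_on_image_Int[OF inj elem_sub[OF that(1)] elem_sub[OF that(2)]]
    unfolding geom_incident_def by auto
  moreover have "\<phi> ` A \<in> lcosets (U i) \<longleftrightarrow> A \<in> lcosets (U i)"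
    if i: "i \<in> I" and A: "A \<in> geom_elements G I U" for i A
  proof
    assume "\<phi> ` A \<in> lcosets (U i)"
    then obtain B where B: "B \<in> lcosets (U i)" "\<phi> ` B = \<phi> ` A"
      using backward i by blast
    then have "B \<in> geom_elements G I U"
      using i unfolding geom_elements_def by blast
    then have "B = A"
      using inj_onD[OF inj_sets B(2)] A by blast
    then show "A \<in> lcosets (U i)"
      using B(1) by simp
  qed (rule forward[OF i])
  ultimately show "acts_as_geom_automorphism G I U \<phi>"
    using inj_sets unfolding acts_as_geom_automorphism_def geom_automorphism_def bij_betw_def
    by (intro conjI ballI)
qed

lemma (in group) generated_automorphism_stabilises:
  assumes "H \<subseteq> auto G" "S \<subseteq> carrier G" and H: "\<And>h. h \<in> H \<Longrightarrow> h ` S = S"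
    and "\<phi> \<in> generate (AutoGroup G) H"
  shows "\<phi> ` S = S"
proof -
  interpret A: group "AutoGroup G" by (rule AutoGroup)
  have Bij: "h \<in> Bij (carrier G)" if "h \<in> generate (AutoGroup G) H" for h
    using A.generate_in_carrier[OF _ that] assms(1) by (auto simp: AutoGroup_def auto_def)
  have compose: "h \<otimes>\<^bsub>AutoGroup G\<^esub> k = compose (carrier G) h k"
    if "h \<in> Bij (carrier G)" "k \<in> Bij (carrier G)" for h k
    using that by (simp add: AutoGroup_def BijGroup_def)
  have image_mult: "(h \<otimes>\<^bsub>AutoGroup G\<^esub> k) ` S = h ` k ` S"
    if "h \<in> Bij (carrier G)" "k \<in> Bij (carrier G)" for h k
    using assms(2) unfolding compose[OF that] by (force simp: compose_def)
  have image_one: "\<one>\<^bsub>AutoGroup G\<^esub> ` S = S"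
    using assms(2) by (force simp: AutoGroup_def BijGroup_def)
  show ?thesis
    using assms(4)
  proof (induction rule: generate.induct)
    case one
    show ?case by (rule image_one)
  next
    case (incl h)
    then show ?case by (rule H)
  next
    case (inv h)
    let ?k = "inv\<^bsub>AutoGroup G\<^esub> h"
    have h: "h \<in> carrier (AutoGroup G)"
      using inv assms(1) by (auto simp: AutoGroup_def)
    have "?k ` S = ?k ` h ` S"
      using H[OF inv] by simp
    also have "\<dots> = (?k \<otimes>\<^bsub>AutoGroup G\<^esub> h) ` S"
      using Bij generate.inv[OF inv] generate.incl[OF inv] by (intro image_mult[symmetric]) auto
    also have "\<dots> = S"
      using h image_one by simp
    finally show ?case .
  next
    case (eng h k)
    then show ?case
      using image_mult[OF Bij Bij] by simp
  qed
qed


section \<open>The unitriangular group and its root elements\<close>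

lemma UT_simps [simp]:
  "x \<otimes>\<^bsub>UT n\<^esub> y = x * y" "\<one>\<^bsub>UT n\<^esub> = 1\<^sub>m n"
  by (simp_all add: UT_def)

lemma UT_carrier_iff:
  "A \<in> carrier (UT n) \<longleftrightarrow>
     A \<in> carrier_mat n n \<and> (\<forall>r<n. \<forall>c<r. A $$ (r, c) = 0) \<and> (\<forall>r<n. A $$ (r, r) = 1)"
  by (auto simp: UT_def upper_triangular_def)

lemma index_mult_mat_sum:
  assumes "A \<in> carrier_mat n n" "B \<in> carrier_mat n n" "r < n" "c < n"
  shows "(A * B) $$ (r, c) = (\<Sum>k<n. A $$ (r, k) * B $$ (k, c))"
  using assms by (simp add: scalar_prod_def atLeast0LessThan)

lemma UT_mult_closed:
  assumes A: "A \<in> carrier (UT n)" and B: "B \<in> carrier (UT n)"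
  shows "A * B \<in> carrier (UT n)"
proof -
  have carr: "A \<in> carrier_mat n n" "B \<in> carrier_mat n n"
    using A B by (auto simp: UT_carrier_iff)
  have "(A * B) $$ (r, c) = 0" if "r < n" "c < r" for r c
  proof -
    have "A $$ (r, k) * B $$ (k, c) = 0" if "k < n" for k
      using A B \<open>r < n\<close> \<open>c < r\<close> that by (cases "k < r") (auto simp: UT_carrier_iff)
    then show ?thesis
      using that by (simp add: index_mult_mat_sum[OF carr] sum.neutral)
  qed
  moreover have "(A * B) $$ (r, r) = 1" if "r < n" for r
  proof -
    have "A $$ (r, k) * B $$ (k, r) = (if k = r then 1 else 0)" if "k < n" for k
      using A B \<open>r < n\<close> that by (cases k r rule: linorder_cases) (auto simp: UT_carrier_iff)
    then show ?thesis
      using that by (subst index_mult_mat_sum[OF carr]) auto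
  qed
  ultimately show ?thesis
    using carr by (auto simp: UT_carrier_iff)
qed

lemma one_in_UT: "1\<^sub>m n \<in> carrier (UT n)"
  by (auto simp: UT_carrier_iff)

lemma addrow_mat_in_UT: "r < s \<Longrightarrow> addrow_mat n t r s \<in> carrier (UT n)"
  by (auto simp: UT_carrier_iff)

lemma elem_mat_eq_addrow_mat:
  "1 \<le> i \<Longrightarrow> i < n \<Longrightarrow> elem_mat n i t = addrow_mat n t (i - 1) i"
  by (rule eq_matI) (auto simp: elem_mat_def)

lemma elem_mat_in_UT: "1 \<le> i \<Longrightarrow> i < n \<Longrightarrow> elem_mat n i t \<in> carrier (UT n)"
  by (simp add: elem_mat_eq_addrow_mat addrow_mat_in_UT)

lemma index_elem_mat:
  "1 \<le> i \<Longrightarrow> i < n \<Longrightarrow> elem_mat n i t $$ (i - 1, i) = t"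
  by (auto simp: elem_mat_def)

text \<open>
  The root element \<open>1 + a * E r s\<close> is \<open>addrow_mat n a r s\<close>, so products with it on the left are
  row operations. The next identity is the commutator formula for root elements, multiplied out so
  that no inverse occurs.
\<close>
lemma addrow_mat_commutator:
  fixes a b :: "'a :: field"
  assumes "r < s" "s < t" "t < n"
  shows "addrow_mat n a r s * addrow_mat n b s t =
         addrow_mat n (a * b) r t * (addrow_mat n b s t * addrow_mat n a r s)"
  using assms
  by (subst (1 2 3) addrow_mat[of _ n n, symmetric])
     (auto intro!: eq_matI simp: algebra_simps)

lemma addrow_mat_add:
  fixes a b :: "'a :: field"
  assumes "r < s" "s < n"
  shows "addrow_mat n a r s * addrow_mat n b r s = addrow_mat n (a + b) r s"
  using assms
  by (subst addrow_mat[of _ n n, symmetric])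
     (auto intro!: eq_matI simp: algebra_simps)

lemma addrow_mat_zero: "addrow_mat n (0 :: 'a :: field) r s = 1\<^sub>m n"
  by (rule eq_matI) auto


text \<open>
  Take an entry \<open>(r, s)\<close> to clear in the last column \<open>s\<close> that has nonzero entries off the diagonal.
  Subtracting a multiple of row \<open>s\<close> from row \<open>r\<close> then affects no other entry, so the number of
  nonzero entries off the diagonal drops.
\<close>
lemma UT_row_reduction_induct [consumes 1, case_names one addrow]:
  fixes A :: "'a :: field mat"
  assumes "A \<in> carrier (UT n)" and one: "P (1\<^sub>m n)"
    and addrow: "\<And>r s t B. r < s \<Longrightarrow> s < n \<Longrightarrow> B \<in> carrier (UT n) \<Longrightarrow> P B \<Longrightarrow>
                   P (addrow_mat n t r s * B)"
  shows "P A"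
  using assms(1)
proof (induction "card {(r, s). r < s \<and> s < n \<and> A $$ (r, s) \<noteq> 0}" arbitrary: A rule: less_induct)
  case less
  let ?supp = "\<lambda>A :: 'a mat. {(r, s). r < s \<and> s < n \<and> A $$ (r, s) \<noteq> 0}"
  have fin: "finite (?supp A)"
    by (rule finite_subset[of _ "{..<n} \<times> {..<n}"]) auto
  have A: "A \<in> carrier_mat n n" "\<And>r c. r < n \<Longrightarrow> c < r \<Longrightarrow> A $$ (r, c) = 0"
    "\<And>r. r < n \<Longrightarrow> A $$ (r, r) = 1"
    using less.prems by (auto simp: UT_carrier_iff)
  show ?case
  proof (cases "?supp A = {}")
    case True
    have "A = 1\<^sub>m n"
    proof (rule eq_matI)
      fix r c assume "r < dim_row (1\<^sub>m n :: 'a mat)" "c < dim_col (1\<^sub>m n :: 'a mat)"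
      then show "A $$ (r, c) = 1\<^sub>m n $$ (r, c)"
        using A True by (cases r c rule: linorder_cases) auto
    qed (use A in auto)
    then show ?thesis using one by simp
  next
    case False
    define s where "s = Max (snd ` ?supp A)"
    have "s \<in> snd ` ?supp A"
      unfolding s_def using fin False by (intro Max_in) auto
    then obtain r where rs: "r < s" "s < n" "A $$ (r, s) \<noteq> 0"
      by auto
    have s_max: "A $$ (k, c) = 0" if "s < c" "k < c" "c < n" for k c
    proof (rule ccontr)
      assume "A $$ (k, c) \<noteq> 0"
      then have "c \<in> snd ` ?supp A"
        using that by force
      then have "c \<le> s"
        unfolding s_def using fin by (intro Max_ge) auto
      then show False using that by simp
    qed
    let ?t = "A $$ (r, s)"
    define B where "B = addrow_mat n (- ?t) r s * A"
    have B_addrow: "B = addrow (- ?t) r s A"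
      unfolding B_def using A(1) rs by (simp add: addrow_mat)
    \<comment> \<open>Row \<open>s\<close> of \<open>A\<close> is a row of the identity, so only the entry at \<open>(r, s)\<close> changes.\<close>
    have row_s: "A $$ (s, c) = (if c = s then 1 else 0)" if "c < n" for c
      using that A rs s_max[of c s] by (cases c s rule: linorder_cases) auto
    have B_index: "B $$ (k, c) = (if k = r \<and> c = s then 0 else A $$ (k, c))"
      if "k < n" "c < n" for k c
      using that A(1) row_s unfolding B_addrow by auto
    have B: "B \<in> carrier (UT n)"
      unfolding B_def using rs less.prems by (intro UT_mult_closed addrow_mat_in_UT)
    have "?supp B = ?supp A - {(r, s)}"
      using B_index by (auto split: if_splits)
    then have "?supp B \<subset> ?supp A"
      using rs by auto
    then have "card (?supp B) < card (?supp A)"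
      by (rule psubset_card_mono[OF fin])
    then have "P B"
      using less.hyps B by blast
    have "addrow_mat n ?t r s * B = (addrow_mat n ?t r s * addrow_mat n (- ?t) r s) * A"
      unfolding B_def using A(1) by (simp add: assoc_mult_mat[of _ n n _ n _ n])
    also have "\<dots> = A"
      using A(1) rs addrow_mat_inv[of r n s ?t] by simp
    finally show ?thesis
      using addrow[OF rs(1,2) B \<open>P B\<close>, of ?t] by simp
  qed
qed

text \<open>
  By row reduction it suffices to obtain all root elements, and these arise from the simple ones
  as commutators, by induction on the distance to the diagonal. The rule needs no case for inverses
  because the inverse of \<open>elem_mat n i t\<close> is \<open>elem_mat n i (- t)\<close>.
\<close>
lemma UT_generated_by_elem_mats [consumes 1, case_names one elem_mat mult]:
  fixes A :: "'a :: field mat"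
  assumes "A \<in> carrier (UT n)" and one: "P (1\<^sub>m n)"
    and elem: "\<And>i t. 1 \<le> i \<Longrightarrow> i < n \<Longrightarrow> P (elem_mat n i t)"
    and mult: "\<And>A B. A \<in> carrier (UT n) \<Longrightarrow> B \<in> carrier (UT n) \<Longrightarrow> P A \<Longrightarrow> P B \<Longrightarrow> P (A * B)"
  shows "P A"
proof -
  have root: "P (addrow_mat n t r s)" if "Suc r \<le> s" "s < n" for r s t
    using that
  proof (induction s arbitrary: t rule: dec_induct)
    case base
    then show ?case
      using elem[of "Suc r" t] by (simp add: elem_mat_eq_addrow_mat)
  next
    case (step s)
    have simple: "P (addrow_mat n u s (Suc s))" for u
      using elem[of "Suc s" u] step.prems by (simp add: elem_mat_eq_addrow_mat)
    \<comment> \<open>the commutator of the root elements at \<open>(r, s)\<close> and \<open>(s, Suc s)\<close> with parameters \<open>t\<close> and \<open>1\<close>\<close>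
    have "addrow_mat n t r (Suc s) =
          addrow_mat n t r s * (addrow_mat n 1 s (Suc s) *
          (addrow_mat n (- t) r s * addrow_mat n (- 1) s (Suc s)))"
      using step.hyps step.prems
      by (subst (1 2 3) addrow_mat[of _ n n, symmetric]) (auto simp: algebra_simps)
    moreover have "P (\<dots>)"
      using step simple by (intro mult UT_mult_closed addrow_mat_in_UT) auto
    ultimately show ?case
      by simp
  qed
  from assms(1) show ?thesis
  proof (induction rule: UT_row_reduction_induct)
    case one
    show ?case by (rule \<open>P (1\<^sub>m n)\<close>)
  next
    case (addrow r s t B)
    then show ?case
      using root[of r s t] by (intro mult addrow_mat_in_UT) auto
  qed
qed

lemma group_UT: "group (UT n :: 'a :: field mat monoid)"
proof (rule groupI)
  fix A B C :: "'a mat"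
  assume "A \<in> carrier (UT n)" "B \<in> carrier (UT n)" "C \<in> carrier (UT n)"
  then show "A \<otimes>\<^bsub>UT n\<^esub> B \<otimes>\<^bsub>UT n\<^esub> C = A \<otimes>\<^bsub>UT n\<^esub> (B \<otimes>\<^bsub>UT n\<^esub> C)"
    by (simp add: UT_carrier_iff assoc_mult_mat[of _ n n _ n _ n])
next
  fix A :: "'a mat"
  assume "A \<in> carrier (UT n)"
  then show "\<exists>B\<in>carrier (UT n). B \<otimes>\<^bsub>UT n\<^esub> A = \<one>\<^bsub>UT n\<^esub>"
  proof (induction rule: UT_row_reduction_induct)
    case one
    show ?case
      by (rule bexI[OF _ one_in_UT]) simp
  next
    case (addrow r s t B)
    let ?E = "\<lambda>t. addrow_mat n t r s :: 'a mat"
    obtain C where C: "C \<in> carrier (UT n)" "C * B = 1\<^sub>m n"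
      using addrow.IH by auto
    have carr: "B \<in> carrier_mat n n" "C \<in> carrier_mat n n"
      using addrow.hyps C by (auto simp: UT_carrier_iff)
    have "(C * ?E (- t)) * (?E t * B) = C * ((?E (- t) * ?E t) * B)"
      using carr by (simp add: assoc_mult_mat[of _ n n _ n _ n] mult_carrier_mat[of _ n n])
    also have "\<dots> = 1\<^sub>m n"
      using addrow_mat_inv[of r n s "- t"] addrow.hyps carr C by simp
    finally show ?case
      using C addrow.hyps by (intro bexI[of _ "C * ?E (- t)"])
        (auto intro: UT_mult_closed addrow_mat_in_UT)
  qed
qed (simp_all add: UT_mult_closed one_in_UT, auto simp: UT_carrier_iff)

interpretation UT: group "UT n :: 'a :: field mat monoid" for n
  by (rule group_UT)

lemma finite_UT: "finite (carrier (UT n :: 'a :: {field, finite} mat monoid))"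
proof (rule finite_subset)
  show "carrier (UT n) \<subseteq> mat n n ` (({..<n} \<times> {..<n}) \<rightarrow>\<^sub>E (UNIV :: 'a set))"
  proof
    fix A :: "'a mat"
    assume "A \<in> carrier (UT n)"
    then have "A = mat n n (restrict (\<lambda>ij. A $$ ij) ({..<n} \<times> {..<n}))"
      by (intro eq_matI) (auto simp: UT_carrier_iff)
    then show "A \<in> mat n n ` (({..<n} \<times> {..<n}) \<rightarrow>\<^sub>E UNIV)"
      by (metis image_eqI restrict_PiE UNIV_I Pi_I)
  qed
  show "finite (mat n n ` (({..<n} \<times> {..<n}) \<rightarrow>\<^sub>E (UNIV :: 'a set)))"
    by (intro finite_imageI finite_PiE) auto
qed


section \<open>The subgroups of the geometry\<close>

text \<open>
  The \<open>x\<close> with \<open>x * S \<subseteq> S\<close> form a subfield (inverses because \<open>S\<close> is finite), so \<open>S\<close> is closed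
  under the prime field and contains the span of \<open>T\<close>.
\<close>

lemma additive_group_containing_basis_is_UNIV:
  fixes S :: "'a :: {field, finite} set"
  assumes T: "basis_over_prime_field T" "T \<subseteq> S"
    and zero: "0 \<in> S" and add: "\<And>x y. x \<in> S \<Longrightarrow> y \<in> S \<Longrightarrow> x + y \<in> S"
    and minus: "\<And>x. x \<in> S \<Longrightarrow> - x \<in> S"
  shows "S = UNIV"
proof -
  let ?R = "ring_of_type_algebra :: 'a ring"
  interpret R: field ?R by (rule field_from_type_algebra)
  have R: "carrier ?R = UNIV" "\<zero>\<^bsub>?R\<^esub> = 0" "\<one>\<^bsub>?R\<^esub> = 1"
    "x \<oplus>\<^bsub>?R\<^esub> y = x + y" "x \<otimes>\<^bsub>?R\<^esub> y = x * y" for x y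
    by (simp_all add: ring_of_type_algebra_def)
  have R_minus: "\<ominus>\<^bsub>?R\<^esub> x = - x" for x
    by (rule R.minus_equality) (simp_all add: R)
  have R_inv: "inv\<^bsub>?R\<^esub> x = inverse x" if "x \<noteq> 0" for x
    using that by (intro R.inv_char) (simp_all add: R)
  have smult: "\<forall>x\<in>S. k * x \<in> S" if "k \<in> prime_field" for k
    using that unfolding prime_field_def
  proof (induction rule: generate_field.induct)
    case (m_inv k)
    then have k: "k \<noteq> 0" by (simp add: R)
    have "(*) k ` S = S"
      using m_inv k by (intro endo_inj_surj) (auto simp: inj_on_def)
    show ?case
    proof
      fix x assume "x \<in> S"
      then obtain y where "y \<in> S" "x = k * y"
        using \<open>(*) k ` S = S\<close> by blast
      then show "inv\<^bsub>?R\<^esub> k * x \<in> S"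
        using k by (simp add: R_inv mult.assoc[symmetric])
    qed
  qed (auto simp: R R_minus add minus distrib_right mult.assoc)
  obtain ts where ts: "set ts = T" "R.Span prime_field ts = UNIV"
    using T(1) unfolding basis_over_prime_field_def by blast
  have "R.Span prime_field us \<subseteq> S" if "set us \<subseteq> S" for us
    using that
    by (induction us)
       (auto simp: R zero set_add_def set_mult_def r_coset_def R.line_extension_def intro!: add smult[rule_format])
  then show ?thesis
    using ts T(2) by auto
qed

lemma elem_mat_add:
  "1 \<le> i \<Longrightarrow> i < n \<Longrightarrow> elem_mat n i (s :: 'a :: field) * elem_mat n i t = elem_mat n i (s + t)"
  by (simp add: elem_mat_eq_addrow_mat addrow_mat_add)

lemma elem_mat_zero: "elem_mat n i (0 :: 'a :: field) = 1\<^sub>m n"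
  by (rule eq_matI) (auto simp: elem_mat_def)

lemma inv_elem_mat:
  "1 \<le> i \<Longrightarrow> i < n \<Longrightarrow> inv\<^bsub>UT n\<^esub> (elem_mat n i (t :: 'a :: field)) = elem_mat n i (- t)"
  by (rule UT.inv_equality) (simp_all add: elem_mat_in_UT elem_mat_add elem_mat_zero)

lemma UT_sub_subgroup: "subgroup (UT_sub n T i) (UT n)"
  unfolding UT_sub_def by (rule UT.generate_is_subgroup) (auto intro!: elem_mat_in_UT)

lemma elem_mat_in_UT_sub:
  fixes T :: "'a :: {field, finite} set"
  assumes basis: "basis_over_prime_field T" and j: "j \<in> {1..n - 1} - {i}"
  shows "elem_mat n j t \<in> UT_sub n T i"
proof -
  interpret U: subgroup "UT_sub n T i" "UT n" by (rule UT_sub_subgroup)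
  have j': "1 \<le> j" "j < n" using j by auto
  have "{t. elem_mat n j t \<in> UT_sub n T i} = UNIV"
  proof (rule additive_group_containing_basis_is_UNIV[OF basis])
    show "T \<subseteq> {t. elem_mat n j t \<in> UT_sub n T i}"
      using j unfolding UT_sub_def by (blast intro: generate.incl)
    show "0 \<in> {t. elem_mat n j t \<in> UT_sub n T i}"
      using U.one_closed by (simp add: elem_mat_zero)
    fix s t assume "s \<in> {t. elem_mat n j t \<in> UT_sub n T i}" "t \<in> {t. elem_mat n j t \<in> UT_sub n T i}"
    then show "s + t \<in> {t. elem_mat n j t \<in> UT_sub n T i}"
      using U.m_closed[of "elem_mat n j s" "elem_mat n j t"] elem_mat_add[OF j', of s t] by simp
  next
    fix t assume "t \<in> {t. elem_mat n j t \<in> UT_sub n T i}"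
    then show "- t \<in> {t. elem_mat n j t \<in> UT_sub n T i}"
      using U.m_inv_closed[of "elem_mat n j t"] inv_elem_mat[OF j', of t] by simp
  qed
  then show ?thesis by auto
qed

text \<open>
  For the block decomposition of the indices into \<open>{0..<i}\<close> and \<open>{i..<n}\<close>, the matrices in
  \<open>UT n\<close> with zero upper right block are closed under products, and among the simple root elements
  only those with index \<open>i\<close> have a nonzero entry in that block.
\<close>
lemma UT_sub_block_zero:
  assumes "A \<in> UT_sub n T i" "r < i" "i \<le> c" "c < n"
  shows "A $$ (r, c) = 0"
  using assms(1,2-) unfolding UT_sub_def
proof (induction arbitrary: r c rule: generate.induct)
  case one
  then show ?case by simp
next
  case (incl h)
  then show ?case by (auto simp: elem_mat_def)
next
  case (inv h)
  then obtain j t where "h = elem_mat n j t" "1 \<le> j" "j < n" "j \<noteq> i"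
    by auto
  then show ?case
    using inv.prems by (auto simp: inv_elem_mat) (auto simp: elem_mat_def)
next
  case (eng h k)
  have "h \<in> carrier (UT n)" "k \<in> carrier (UT n)"
    using eng.hyps subgroup.subset[OF UT_sub_subgroup] unfolding UT_sub_def by blast+
  then have carr: "h \<in> carrier_mat n n" "k \<in> carrier_mat n n"
    by (auto simp: UT_carrier_iff)
  have "h $$ (r, m) * k $$ (m, c) = 0" if "m < n" for m
    using eng.IH(1)[of r m] eng.IH(2)[of m c] eng.prems that by (cases "m < i") auto
  then show ?case
    using eng.prems by (simp add: index_mult_mat_sum[OF carr] sum.neutral del: index_mult_mat)
qed

text \<open>
  A position \<open>(r, c)\<close> with \<open>r < c\<close> lies in the zero block of \<open>UT_sub n T j\<close> for every
  \<open>j\<close> with \<open>r < j \<le> c\<close>. The only position for which no such \<open>j\<close> differs from \<open>i\<close> is \<open>(i - 1, i)\<close>.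
\<close>
lemma Inter_UT_sub_eq_range_elem_mat:
  fixes T :: "'a :: {field, finite} set"
  assumes basis: "basis_over_prime_field T" and n: "n > 2" and i: "1 \<le> i" "i < n"
  shows "(\<Inter>j\<in>{1..n - 1} - {i}. UT_sub n T j) = range (elem_mat n i)"
proof
  show "range (elem_mat n i) \<subseteq> (\<Inter>j\<in>{1..n - 1} - {i}. UT_sub n T j)"
    using i by (auto intro!: elem_mat_in_UT_sub[OF basis])
  show "(\<Inter>j\<in>{1..n - 1} - {i}. UT_sub n T j) \<subseteq> range (elem_mat n i)"
  proof
    fix A assume A: "A \<in> (\<Inter>j\<in>{1..n - 1} - {i}. UT_sub n T j)"
    \<comment> \<open>As \<open>n > 2\<close>, the intersection is not over the empty family.\<close>
    define j where "j = (if i = 1 then 2 else 1 :: nat)"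
    have "j \<in> {1..n - 1} - {i}"
      using n by (auto simp: j_def)
    then have "A \<in> carrier (UT n)"
      using A subgroup.subset[OF UT_sub_subgroup] by blast
    then have AUT: "A \<in> carrier_mat n n" "\<And>r c. r < n \<Longrightarrow> c < r \<Longrightarrow> A $$ (r, c) = 0"
      "\<And>r. r < n \<Longrightarrow> A $$ (r, r) = 1"
      by (auto simp: UT_carrier_iff)
    have zero: "A $$ (r, c) = 0" if "r < j" "j \<le> c" "c < n" "j \<noteq> i" for r c j
      using A that by (intro UT_sub_block_zero[of A n T j]) auto
    have "A = elem_mat n i (A $$ (i - 1, i))"
    proof (rule eq_matI)
      fix r c assume "r < dim_row (elem_mat n i (A $$ (i - 1, i)))"
        "c < dim_col (elem_mat n i (A $$ (i - 1, i)))"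
      then have rc: "r < n" "c < n" by (auto simp: elem_mat_def)
      consider "c \<le> r" | "c = i" "r = i - 1" | "r < c" "\<not> (c = i \<and> r = i - 1)"
        by linarith
      then show "A $$ (r, c) = elem_mat n i (A $$ (i - 1, i)) $$ (r, c)"
      proof cases
        case 1
        then show ?thesis
          using rc AUT i by (cases "c = r") (auto simp: elem_mat_def)
      next
        case 2
        show ?thesis
          unfolding 2 by (rule index_elem_mat[OF i, symmetric])
      next
        case 3
        then have "A $$ (r, c) = 0"
          using rc zero[of r c c] zero[of r "Suc r" c] i by (cases "c = i") auto
        then show ?thesis
          using 3 rc by (auto simp: elem_mat_def)
      qed
    qed (use AUT(1) in \<open>auto simp: elem_mat_def\<close>)
    then show "A \<in> range (elem_mat n i)" by blast
  qed
qed


section \<open>Diagonal and field automorphisms\<close>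

text \<open>Surjectivity is automatic because the group is finite.\<close>
lemma UT_endomorphism_in_auto:
  fixes f :: "'a :: {field, finite} mat \<Rightarrow> 'a mat"
  assumes "f ` carrier (UT n) \<subseteq> carrier (UT n)" "inj_on f (carrier (UT n))"
    and "\<And>A B. A \<in> carrier (UT n) \<Longrightarrow> B \<in> carrier (UT n) \<Longrightarrow> f (A * B) = f A * f B"
  shows "restrict f (carrier (UT n)) \<in> auto (UT n)"
proof -
  have "f ` carrier (UT n) = carrier (UT n)"
    using assms(1,2) by (intro endo_inj_surj finite_UT)
  then show ?thesis
    using assms by (auto simp: auto_def hom_def Bij_def bij_betw_def UT_mult_closed inj_on_def)
qed

lemma conj_mat_diag_index:
  assumes "A \<in> carrier_mat n n" "r < n" "c < n"
  shows "(mat_diag n d * A * mat_diag n e) $$ (r, c) = d r * A $$ (r, c) * e c"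
  using assms by (simp add: mat_diag_mult_left[of _ n n] mat_diag_mult_right[of _ n n])

lemma Aut_D_subset_auto: "Aut_D n \<subseteq> auto (UT n :: 'a :: {field, finite} mat monoid)"
proof
  fix \<phi> :: "'a mat \<Rightarrow> 'a mat"
  assume "\<phi> \<in> Aut_D n"
  then obtain d where d: "\<And>i. i < n \<Longrightarrow> d i \<noteq> 0" and
    phi: "\<phi> = (\<lambda>x\<in>carrier (UT n). mat_diag n d * x * mat_diag n (\<lambda>i. inverse (d i)))"
    unfolding Aut_D_def by blast
  let ?e = "\<lambda>i. inverse (d i)"
  let ?f = "\<lambda>x. mat_diag n d * x * mat_diag n ?e"
  have cancel: "mat_diag n ?e * mat_diag n d = 1\<^sub>m n"
    unfolding mat_diag_diag using d by (auto simp: mat_diag_def intro!: eq_matI)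
  have carr: "A \<in> carrier_mat n n" if "A \<in> carrier (UT n)" for A :: "'a mat"
    using that by (simp add: UT_carrier_iff)
  have index: "?f A $$ (r, c) = d r * A $$ (r, c) * ?e c"
    if "A \<in> carrier (UT n)" "r < n" "c < n" for A :: "'a mat" and r c
    using conj_mat_diag_index[OF carr] that by blast
  have f_carr: "?f A \<in> carrier_mat n n" if "A \<in> carrier (UT n)" for A :: "'a mat"
    using carr[OF that] by (simp add: mult_carrier_mat[of _ n n])
  show "\<phi> \<in> auto (UT n)"
    unfolding phi
  proof (rule UT_endomorphism_in_auto)
    show "?f ` carrier (UT n) \<subseteq> carrier (UT n)"
    proof
      fix B :: "'a mat" assume "B \<in> ?f ` carrier (UT n)"
      then obtain A where A: "A \<in> carrier (UT n)" and B: "B = ?f A"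
        by blast
      show "B \<in> carrier (UT n)"
        unfolding UT_carrier_iff B
        using A d by (auto simp: f_carr index UT_carrier_iff simp del: index_mult_mat)
    qed
    show "inj_on ?f (carrier (UT n))"
    proof (rule inj_onI)
      fix A B :: "'a mat" assume A: "A \<in> carrier (UT n)" and B: "B \<in> carrier (UT n)" and eq: "?f A = ?f B"
      show "A = B"
      proof (rule eq_matI)
        fix r c assume "r < dim_row B" "c < dim_col B"
        then have rc: "r < n" "c < n" using carr[OF B] by auto
        then show "A $$ (r, c) = B $$ (r, c)"
          using index[OF A rc] index[OF B rc] d unfolding eq by auto
      qed (use carr[OF A] carr[OF B] in auto)
    qed
    fix A B :: "'a mat" assume A: "A \<in> carrier (UT n)" and B: "B \<in> carrier (UT n)"
    have "?f A * ?f B = mat_diag n d * (A * ((mat_diag n ?e * mat_diag n d) * (B * mat_diag n ?e)))"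
      using carr[OF A] carr[OF B]
      by (simp add: assoc_mult_mat[of _ n n _ n _ n] mult_carrier_mat[of _ n n] del: mat_diag_diag)
    also have "\<dots> = ?f (A * B)"
      unfolding cancel using carr[OF A] carr[OF B]
      by (simp add: assoc_mult_mat[of _ n n _ n _ n] mult_carrier_mat[of _ n n])
    finally show "?f (A * B) = ?f A * ?f B"
      by simp
  qed
qed

lemma ring_iso_type_algebra_iff:
  "\<sigma> \<in> ring_iso (ring_of_type_algebra :: 'a :: field ring) ring_of_type_algebra \<longleftrightarrow>
     bij \<sigma> \<and> \<sigma> 1 = 1 \<and> (\<forall>x y. \<sigma> (x + y) = \<sigma> x + \<sigma> y) \<and> (\<forall>x y. \<sigma> (x * y) = \<sigma> x * \<sigma> y)"
  by (auto simp: ring_iso_def ring_hom_def ring_of_type_algebra_def)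

lemma additive_zero:
  fixes f :: "'a :: group_add \<Rightarrow> 'b :: group_add"
  assumes "\<And>x y. f (x + y) = f x + f y"
  shows "f 0 = 0"
  using assms[of 0 0] by (metis add_0_right add_left_cancel)

lemma Aut_F_subset_auto: "Aut_F n \<subseteq> auto (UT n :: 'a :: {field, finite} mat monoid)"
proof
  fix \<phi> :: "'a mat \<Rightarrow> 'a mat"
  assume "\<phi> \<in> Aut_F n"
  then obtain \<sigma> where phi: "\<phi> = (\<lambda>x\<in>carrier (UT n). map_mat \<sigma> x)" and
    \<sigma>: "bij \<sigma>" "\<sigma> 1 = 1" "\<And>x y. \<sigma> (x + y) = \<sigma> x + \<sigma> y" "\<And>x y. \<sigma> (x * y) = \<sigma> x * \<sigma> y"
    unfolding Aut_F_def ring_iso_type_algebra_iff by blast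
  have "\<sigma> 0 = 0"
    by (rule additive_zero) (rule \<sigma>(3))
  then interpret semiring_hom \<sigma>
    by unfold_locales (use \<sigma> in auto)
  have carr: "A \<in> carrier_mat n n" if "A \<in> carrier (UT n)" for A :: "'a mat"
    using that by (simp add: UT_carrier_iff)
  show "\<phi> \<in> auto (UT n)"
    unfolding phi
  proof (rule UT_endomorphism_in_auto)
    show "map_mat \<sigma> ` carrier (UT n) \<subseteq> carrier (UT n)"
      by (auto simp: UT_carrier_iff)
    show "inj_on (map_mat \<sigma>) (carrier (UT n))"
    proof (rule inj_onI)
      fix A B :: "'a mat" assume A: "A \<in> carrier (UT n)" and B: "B \<in> carrier (UT n)"
        and eq: "map_mat \<sigma> A = map_mat \<sigma> B"
      show "A = B"
      proof (rule eq_matI)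
        fix r c assume "r < dim_row B" "c < dim_col B"
        then have rc: "r < n" "c < n" using carr[OF B] by auto
        then have "\<sigma> (A $$ (r, c)) = \<sigma> (B $$ (r, c))"
          using arg_cong[OF eq, of "\<lambda>M. M $$ (r, c)"] carr[OF A] carr[OF B] by simp
        then show "A $$ (r, c) = B $$ (r, c)"
          using \<sigma>(1) by (simp add: bij_def inj_eq)
      qed (use carr[OF A] carr[OF B] in auto)
    qed
    fix A B :: "'a mat" assume A: "A \<in> carrier (UT n)" and B: "B \<in> carrier (UT n)"
    show "map_mat \<sigma> (A * B) = map_mat \<sigma> A * map_mat \<sigma> B"
      by (rule mat_hom_mult[OF carr[OF A] carr[OF B]])
  qed
qed

lemma conj_mat_diag_elem_mat:
  assumes "1 \<le> i" "i < n" "\<And>i. i < n \<Longrightarrow> d i \<noteq> (0 :: 'a :: field)"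
  shows "mat_diag n d * elem_mat n i t * mat_diag n (\<lambda>i. inverse (d i)) =
         elem_mat n i (d (i - 1) * t / d i)"
proof (rule eq_matI)
  have carr: "elem_mat n i u \<in> carrier_mat n n" for u :: 'a
    by (simp add: elem_mat_def)
  {
    fix r c assume "r < dim_row (elem_mat n i (d (i - 1) * t / d i))"
      "c < dim_col (elem_mat n i (d (i - 1) * t / d i))"
    then have "r < n" "c < n" by (simp_all add: elem_mat_def)
    then show "(mat_diag n d * elem_mat n i t * mat_diag n (\<lambda>i. inverse (d i))) $$ (r, c) =
      elem_mat n i (d (i - 1) * t / d i) $$ (r, c)"
      unfolding conj_mat_diag_index[OF carr \<open>r < n\<close> \<open>c < n\<close>]
      using assms by (auto simp: elem_mat_def field_simps)
  }
qed (auto simp: elem_mat_def mat_diag_def)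

lemma map_mat_elem_mat:
  "\<sigma> 0 = 0 \<Longrightarrow> \<sigma> 1 = 1 \<Longrightarrow> map_mat \<sigma> (elem_mat n i t) = elem_mat n i (\<sigma> t)"
  by (rule eq_matI) (auto simp: elem_mat_def)

lemma Aut_D_elem_mat:
  assumes "h \<in> Aut_D n" "1 \<le> i" "i < n"
  shows "h (elem_mat n i t) \<in> range (elem_mat n i)"
  using assms by (auto simp: Aut_D_def elem_mat_in_UT conj_mat_diag_elem_mat)

lemma Aut_F_elem_mat:
  assumes "h \<in> Aut_F n" "1 \<le> i" "i < n"
  shows "h (elem_mat n i t) \<in> range (elem_mat n i)"
proof -
  obtain \<sigma> where "h = (\<lambda>x\<in>carrier (UT n). map_mat \<sigma> x)" "\<sigma> 1 = 1"
    and "\<And>x y. \<sigma> (x + y) = \<sigma> x + \<sigma> y"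
    using assms(1) unfolding Aut_F_def ring_iso_type_algebra_iff by blast
  then show ?thesis
    using assms(2,3) additive_zero[of \<sigma>] by (simp add: elem_mat_in_UT map_mat_elem_mat)
qed

text \<open>
  The image of a generator stays in its root subgroup, but its parameter may leave \<open>T\<close>; this is
  where \<open>elem_mat_in_UT_sub\<close> is needed. Equality follows from inclusion by finiteness.
\<close>
lemma UT_sub_stabilised:
  fixes T :: "'a :: {field, finite} set"
  assumes basis: "basis_over_prime_field T" and h: "h \<in> auto (UT n)"
    and elem: "\<And>j t. 1 \<le> j \<Longrightarrow> j < n \<Longrightarrow> h (elem_mat n j t) \<in> range (elem_mat n j)"
  shows "h ` UT_sub n T i = UT_sub n T i"
proof (rule endo_inj_surj)
  let ?X = "{elem_mat n j t | j t. j \<in> {1..n - 1} - {i} \<and> t \<in> T}"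
  have sub: "UT_sub n T i \<subseteq> carrier (UT n)"
    by (rule subgroup.subset[OF UT_sub_subgroup])
  show "finite (UT_sub n T i)"
    by (rule finite_subset[OF sub finite_UT])
  show "inj_on h (UT_sub n T i)"
    using autoD(2)[OF h] sub by (auto simp: bij_betw_def intro: inj_on_subset)
  interpret h: group_hom "UT n" "UT n" h
    using autoD(1)[OF h] by unfold_locales
  have "h ` UT_sub n T i = generate (UT n) (h ` ?X)"
    unfolding UT_sub_def by (rule h.generate_img[symmetric]) (auto intro!: elem_mat_in_UT)
  also have "\<dots> \<subseteq> UT_sub n T i"
  proof (rule UT.generate_subgroup_incl[OF _ UT_sub_subgroup])
    show "h ` ?X \<subseteq> UT_sub n T i"
    proof
      fix y assume "y \<in> h ` ?X"
      then obtain j t where j: "j \<in> {1..n - 1} - {i}" and y: "y = h (elem_mat n j t)"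
        by blast
      have "1 \<le> j" "j < n" using j by auto
      from elem[OF this, of t] obtain u where "y = elem_mat n j u"
        unfolding y by blast
      then show "y \<in> UT_sub n T i"
        using elem_mat_in_UT_sub[OF basis j] by simp
    qed
  qed
  finally show "h ` UT_sub n T i \<subseteq> UT_sub n T i" .
qed


section \<open>Automorphisms that preserve the simple root subgroups\<close>

text \<open>
  Apply \<open>\<phi>\<close> to the commutator formula and cancel the product of the two root elements, which
  appears on the right of both sides.
\<close>
lemma UT_hom_addrow_mat_commutator:
  fixes a b a' b' :: "'a :: field"
  assumes phi: "\<phi> \<in> hom (UT n) (UT n)" and "r < s" "s < t" "t < n"
    and "\<phi> (addrow_mat n a r s) = addrow_mat n a' r s"
    and "\<phi> (addrow_mat n b s t) = addrow_mat n b' s t"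
  shows "\<phi> (addrow_mat n (a * b) r t) = addrow_mat n (a' * b') r t"
proof -
  let ?x = "\<lambda>a. addrow_mat n a r s :: 'a mat" and ?y = "\<lambda>b. addrow_mat n b s t :: 'a mat"
    and ?z = "\<lambda>c. addrow_mat n c r t :: 'a mat"
  have carr: "?x c \<in> carrier (UT n)" "?y c \<in> carrier (UT n)" "?z c \<in> carrier (UT n)" for c
    using assms by (auto intro: addrow_mat_in_UT)
  have mult: "\<phi> (A * B) = \<phi> A * \<phi> B" if "A \<in> carrier (UT n)" "B \<in> carrier (UT n)" for A B
    using hom_mult[OF phi that] by simp
  have phi_carr: "\<phi> A \<in> carrier (UT n)" if "A \<in> carrier (UT n)" for A
    using hom_in_carrier[OF phi that] .
  have "\<phi> (?z (a * b)) * (?y b' * ?x a') = \<phi> (?z (a * b) * (?y b * ?x a))"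
    using assms carr by (simp add: mult UT_mult_closed)
  also have "\<dots> = \<phi> (?x a * ?y b)"
    using addrow_mat_commutator[OF assms(2-4), of a b] by simp
  also have "\<dots> = ?x a' * ?y b'"
    using assms carr by (simp add: mult)
  also have "\<dots> = ?z (a' * b') * (?y b' * ?x a')"
    by (rule addrow_mat_commutator[OF assms(2-4)])
  finally show ?thesis
    using UT.r_cancel[of n "\<phi> (?z (a * b))" "?y b' * ?x a'" "?z (a' * b')"] carr phi_carr
    by (simp add: UT_mult_closed)
qed

text \<open>
  The parameter \<open>s * t\<close> of a commutator can also be written as \<open>(s * t) * 1\<close>; comparing the two
  images under \<open>\<phi>\<close> yields the relation \<open>a_comm\<close> between neighbouring simple roots, from which
  everything else follows. Neighbouring simple roots exist because \<open>n > 2\<close>.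
\<close>
lemma root_preserving_auto_is_diagonal_times_field:
  fixes \<phi> :: "'a :: {field, finite} mat \<Rightarrow> 'a mat"
  assumes n: "n > 2" and phi: "\<phi> \<in> auto (UT n)"
    and root: "\<And>i t. 1 \<le> i \<Longrightarrow> i < n \<Longrightarrow> \<phi> (elem_mat n i t) \<in> range (elem_mat n i)"
  shows "\<exists>d \<sigma>. (\<forall>i<n. d i \<noteq> 0) \<and>
    \<sigma> \<in> ring_iso (ring_of_type_algebra :: 'a ring) ring_of_type_algebra \<and>
    (\<forall>i t. 1 \<le> i \<longrightarrow> i < n \<longrightarrow>
       \<phi> (elem_mat n i t) = elem_mat n i (d (i - 1) * \<sigma> t / d i))"
proof -
  define a where "a i t = \<phi> (elem_mat n i t) $$ (i - 1, i)" for i t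
  have phi_elem: "\<phi> (elem_mat n i t) = elem_mat n i (a i t)" if i: "1 \<le> i" "i < n" for i t
  proof -
    obtain u where "\<phi> (elem_mat n i t) = elem_mat n i u"
      using root[OF i] by blast
    then show ?thesis
      unfolding a_def using index_elem_mat[OF i, of u] by simp
  qed
  have a_unique: "u = v" if "1 \<le> i" "i < n" "elem_mat n i u = elem_mat n i v" for i and u v :: 'a
    using index_elem_mat[OF that(1,2), of u] index_elem_mat[OF that(1,2), of v] that(3) by simp
  have a_add: "a i (s + t) = a i s + a i t" if i: "1 \<le> i" "i < n" for i s t
  proof -
    have "\<phi> (elem_mat n i s * elem_mat n i t) = \<phi> (elem_mat n i s) * \<phi> (elem_mat n i t)"
      using hom_mult[OF autoD(1)[OF phi]] i by (simp add: elem_mat_in_UT)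
    then have "elem_mat n i (a i (s + t)) = elem_mat n i (a i s + a i t)"
      using i by (simp add: phi_elem elem_mat_add)
    then show ?thesis
      by (rule a_unique[OF i])
  qed
  have a_inj: "inj (a i)" if i: "1 \<le> i" "i < n" for i
  proof (rule injI)
    fix s t assume "a i s = a i t"
    then have "\<phi> (elem_mat n i s) = \<phi> (elem_mat n i t)"
      using i by (simp add: phi_elem)
    then have "elem_mat n i s = elem_mat n i t"
      using autoD(2)[OF phi] i by (auto simp: bij_betw_def elem_mat_in_UT dest: inj_onD)
    then show "s = t"
      by (rule a_unique[OF i])
  qed
  have a_zero: "a i 0 = 0" if "1 \<le> i" "i < n" for i
    by (rule additive_zero) (rule a_add[OF that])
  have a_one: "a i 1 \<noteq> 0" if "1 \<le> i" "i < n" for i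
    using injD[OF a_inj[OF that], of 1 0] a_zero[OF that] by auto
  have a_comm: "a i s * a (i + 1) t = a i (s * t) * a (i + 1) 1"
    if i: "1 \<le> i" "i + 1 < n" for i s t
  proof -
    have "\<phi> (addrow_mat n (s * t) (i - 1) (i + 1)) =
          addrow_mat n (a i s * a (i + 1) t) (i - 1) (i + 1)" for s t
      using i phi_elem[of i s] phi_elem[of "i + 1" t]
      by (intro UT_hom_addrow_mat_commutator[OF autoD(1)[OF phi], of _ i])
         (simp_all add: elem_mat_eq_addrow_mat)
    from this[of s t] this[of "s * t" 1]
    have "addrow_mat n (a i s * a (i + 1) t) (i - 1) (i + 1) =
          addrow_mat n (a i (s * t) * a (i + 1) 1) (i - 1) (i + 1)"
      by simp
    from arg_cong[OF this, of "\<lambda>M. M $$ (i - 1, i + 1)"] show ?thesis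
      using i by simp
  qed
  define \<sigma> where "\<sigma> t = a 1 t / a 1 1" for t
  have a_sigma: "a i t = a i 1 * \<sigma> t" if "1 \<le> i" "i < n" for i t
    using that
  proof (induction i rule: dec_induct)
    case base
    then show ?case
      using a_one[of 1] by (simp add: \<sigma>_def)
  next
    case (step i)
    then have "a i t = a i 1 * \<sigma> t" by simp
    then have "a i 1 * a (i + 1) t = a i 1 * (a (i + 1) 1 * \<sigma> t)"
      using a_comm[of i 1 t] step by (simp add: mult.commute mult.left_commute)
    then show ?case
      using a_one[of i] step by simp
  qed
  have one: "a 1 1 \<noteq> 0" "a 2 1 \<noteq> 0"
    using n a_one[of 1] a_one[of 2] by auto
  have "\<sigma> (s * t) = \<sigma> s * \<sigma> t" for s t
  proof -
    have "a 1 s * (a 2 1 * \<sigma> t) = a 1 (s * t) * a 2 1"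
      using a_comm[of 1 s t] a_sigma[of 2 t] n by (simp add: numeral_2_eq_2)
    then have "a 1 s * \<sigma> t = a 1 (s * t)"
      using one by (simp add: mult.left_commute mult.commute)
    then show ?thesis
      by (simp add: \<sigma>_def)
  qed
  moreover have "bij \<sigma>"
  proof -
    have "inj \<sigma>"
      using a_inj[of 1] one(1) n by (auto simp: inj_def \<sigma>_def)
    then show ?thesis
      by (simp add: bij_def finite_UNIV_inj_surj)
  qed
  ultimately have iso: "\<sigma> \<in> ring_iso (ring_of_type_algebra :: 'a ring) ring_of_type_algebra"
    unfolding ring_iso_type_algebra_iff
    using one(1) a_add[of 1] n by (auto simp: \<sigma>_def add_divide_distrib)
  \<comment> \<open>Conjugation by \<open>diag d\<close> scales the entry \<open>(i - 1, i)\<close> by \<open>d (i - 1) / d i\<close>, so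
      \<open>d\<close> has to solve the recursion \<open>d i = d (i - 1) / a i 1\<close>.\<close>
  define d where "d i = (\<Prod>j\<in>{1..i}. inverse (a j 1))" for i
  have d_nonzero: "d i \<noteq> 0" if "i < n" for i
    using that a_one by (auto simp: d_def)
  have d_ratio: "a i 1 = d (i - 1) / d i" if "1 \<le> i" "i < n" for i
  proof -
    have "d i = d (i - 1) * inverse (a i 1)"
      using that(1) unfolding d_def by (cases i) simp_all
    then show ?thesis
      using d_nonzero[OF that(2)] a_one[OF that] by (simp add: field_simps)
  qed
  have "\<phi> (elem_mat n i t) = elem_mat n i (d (i - 1) * \<sigma> t / d i)" if i: "1 \<le> i" "i < n" for i t
    unfolding phi_elem[OF i] a_sigma[OF i, of t] d_ratio[OF i] by simp
  with d_nonzero iso show ?thesis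
    by blast
qed

lemma UT_hom_eqI:
  assumes "\<phi> \<in> hom (UT n) (UT n)" "\<psi> \<in> hom (UT n) (UT n)"
    and "\<And>i t. 1 \<le> i \<Longrightarrow> i < n \<Longrightarrow> \<phi> (elem_mat n i t) = \<psi> (elem_mat n i t)"
    and "A \<in> carrier (UT n)"
  shows "\<phi> A = (\<psi> A :: 'a :: field mat)"
  using assms(4)
proof (induction rule: UT_generated_by_elem_mats)
  case one
  show ?case
    using hom_one[OF assms(1) group_UT group_UT] hom_one[OF assms(2) group_UT group_UT] by simp
next
  case (elem_mat i t)
  then show ?case by (rule assms(3))
next
  case (mult A B)
  then show ?case
    using hom_mult[OF assms(1), of A B] hom_mult[OF assms(2), of A B] by simp
qed

theorem proposition4p6:
  fixes n :: nat
    and T :: "'a :: {field, finite} set"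
    and \<phi> :: "'a mat \<Rightarrow> 'a mat"
  assumes "n > 2"
    and "basis_over_prime_field T"
    and "\<phi> \<in> auto (UT n)"
  shows "acts_as_geom_automorphism (UT n) {1..n - 1} (UT_sub n T) \<phi> \<longleftrightarrow>
         \<phi> \<in> generate (AutoGroup (UT n)) (Aut_D n \<union> Aut_F n)"
proof -
  have subset: "Aut_D n \<union> Aut_F n \<subseteq> auto (UT n :: 'a mat monoid)"
    using Aut_D_subset_auto Aut_F_subset_auto by (rule Un_least)
  have "acts_as_geom_automorphism (UT n) {1..n - 1} (UT_sub n T) \<phi> \<longleftrightarrow>
        (\<forall>i\<in>{1..n - 1}. \<phi> ` UT_sub n T i = UT_sub n T i)"
    by (rule UT.acts_as_geom_automorphism_iff_stabilises[OF assms(3) UT_sub_subgroup])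
  also have "\<dots> \<longleftrightarrow> \<phi> \<in> generate (AutoGroup (UT n)) (Aut_D n \<union> Aut_F n)"
  proof
    assume gen: "\<phi> \<in> generate (AutoGroup (UT n)) (Aut_D n \<union> Aut_F n)"
    have "\<phi> ` UT_sub n T i = UT_sub n T i" for i
    proof (rule UT.generated_automorphism_stabilises[OF subset _ _ gen])
      show "UT_sub n T i \<subseteq> carrier (UT n)"
        by (rule subgroup.subset[OF UT_sub_subgroup])
      fix h :: "'a mat \<Rightarrow> 'a mat" assume h: "h \<in> Aut_D n \<union> Aut_F n"
      show "h ` UT_sub n T i = UT_sub n T i"
      proof (rule UT_sub_stabilised[OF assms(2)])
        show "h \<in> auto (UT n)"
          using h subset by blast
        show "h (elem_mat n j t) \<in> range (elem_mat n j)" if "1 \<le> j" "j < n" for j t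
          using h Aut_D_elem_mat[OF _ that] Aut_F_elem_mat[OF _ that] by auto
      qed
    qed
    then show "\<forall>i\<in>{1..n - 1}. \<phi> ` UT_sub n T i = UT_sub n T i" by blast
  next
    assume stab: "\<forall>i\<in>{1..n - 1}. \<phi> ` UT_sub n T i = UT_sub n T i"
    have root: "\<phi> (elem_mat n i t) \<in> range (elem_mat n i)" if i: "1 \<le> i" "i < n" for i t
    proof -
      have "\<phi> (elem_mat n i t) \<in> UT_sub n T j" if j: "j \<in> {1..n - 1} - {i}" for j
      proof -
        have "elem_mat n i t \<in> UT_sub n T j"
          using i j by (intro elem_mat_in_UT_sub[OF assms(2)]) auto
        then show ?thesis
          using stab j by (metis DiffD1 imageI)
      qed
      then show ?thesis
        using Inter_UT_sub_eq_range_elem_mat[OF assms(2,1) i] by blast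
    qed
    obtain d \<sigma> where d: "\<And>i. i < n \<Longrightarrow> d i \<noteq> 0"
      and \<sigma>: "\<sigma> \<in> ring_iso (ring_of_type_algebra :: 'a ring) ring_of_type_algebra"
      and elem: "\<And>i t. 1 \<le> i \<Longrightarrow> i < n \<Longrightarrow>
        \<phi> (elem_mat n i t) = elem_mat n i (d (i - 1) * \<sigma> t / d i)"
      using root_preserving_auto_is_diagonal_times_field[OF assms(1,3) root] by blast
    define \<delta> where
      "\<delta> = (\<lambda>x\<in>carrier (UT n). mat_diag n d * x * mat_diag n (\<lambda>i. inverse (d i)))"
    define \<epsilon> where "\<epsilon> = (\<lambda>x\<in>carrier (UT n). map_mat \<sigma> x)"
    have "\<delta> \<in> Aut_D n" "\<epsilon> \<in> Aut_F n"
      unfolding Aut_D_def Aut_F_def \<delta>_def \<epsilon>_def using d \<sigma> by blast+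
    then have gen: "\<delta> \<otimes>\<^bsub>AutoGroup (UT n)\<^esub> \<epsilon> \<in> generate (AutoGroup (UT n)) (Aut_D n \<union> Aut_F n)"
      by (intro generate.eng generate.incl) auto
    have in_auto: "\<delta> \<in> auto (UT n)" "\<epsilon> \<in> auto (UT n)"
      using \<open>\<delta> \<in> Aut_D n\<close> \<open>\<epsilon> \<in> Aut_F n\<close> subset by auto
    then have mult: "\<delta> \<otimes>\<^bsub>AutoGroup (UT n)\<^esub> \<epsilon> = compose (carrier (UT n)) \<delta> \<epsilon>"
      by (simp add: AutoGroup_def BijGroup_def auto_def)
    have hom: "compose (carrier (UT n)) \<delta> \<epsilon> \<in> hom (UT n) (UT n)"
      by (rule UT.hom_compose[OF autoD(1)[OF in_auto(2)] autoD(1)[OF in_auto(1)]])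
    have sigma: "\<sigma> 0 = 0" "\<sigma> 1 = 1"
      using \<sigma> additive_zero[of \<sigma>] unfolding ring_iso_type_algebra_iff by auto
    have "\<phi> (elem_mat n i t) = compose (carrier (UT n)) \<delta> \<epsilon> (elem_mat n i t)"
      if "1 \<le> i" "i < n" for i t
      using that d sigma
      by (simp add: elem compose_eq elem_mat_in_UT \<delta>_def \<epsilon>_def map_mat_elem_mat conj_mat_diag_elem_mat)
    then have "\<phi> A = compose (carrier (UT n)) \<delta> \<epsilon> A" if "A \<in> carrier (UT n)" for A
      by (rule UT_hom_eqI[OF autoD(1)[OF assms(3)] hom _ that])
    then have "\<phi> = compose (carrier (UT n)) \<delta> \<epsilon>"
      by (intro extensionalityI[OF autoD(3)[OF assms(3)] compose_extensional])
    then show "\<phi> \<in> generate (AutoGroup (UT n)) (Aut_D n \<union> Aut_F n)"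
      using gen mult by simp
  qed
  finally show ?thesis .
qed

end
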